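(* For any integer $k\ge1$ and any odd prime $p$, there exists a group $G$ and a finite normal subgroup $H\lhd G$ of order $p$ such that $G/H$ is $k$-step nilpotent, but $G$ is not virtually $k$-step nilpotent.
   Context: A group is $k$-step nilpotent if it is nilpotent of class at most $k$. A group is virtually $k$-step nilpotent if it has a $k$-step nilpotent subgroup of finite index. *)

theory Defs
  imports "HOL-Algebra.Generated_Groups" "HOL-Computational_Algebra.Primes"
begin

definition commutator_subgroup :: "('a, 'b) monoid_scheme \<Rightarrow> 'a set \<Rightarrow> 'a set \<Rightarrow> 'a set" where
  "commutator_subgroup G A B =
     generate G {x \<otimes>\<^bsub>G\<^esub> y \<otimes>\<^bsub>G\<^esub> inv\<^bsub>G\<^esub> x \<otimes>\<^bsub>G\<^esub> inv\<^bsub>G\<^esub> y | x y. x \<in> A \<and> y \<in> B}"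

text \<open>Indexed from \<open>0\<close>: term \<open>n\<close> is what is usually written \<open>\<gamma>\<^sub>n\<^sub>+\<^sub>1(G)\<close>.\<close>

primrec lower_central_series :: "('a, 'b) monoid_scheme \<Rightarrow> nat \<Rightarrow> 'a set" where
  "lower_central_series G 0 = carrier G"
| "lower_central_series G (Suc n) = commutator_subgroup G (lower_central_series G n) (carrier G)"

definition step_nilpotent :: "nat \<Rightarrow> ('a, 'b) monoid_scheme \<Rightarrow> bool" where
  "step_nilpotent k G \<longleftrightarrow> group G \<and> lower_central_series G k = {\<one>\<^bsub>G\<^esub>}"

text \<open>The index of \<open>K\<close> is expressed by finiteness of the set of its right cosets, since
  \<open>card\<close> of an infinite set is \<open>0\<close>.\<close>

definition virtually_step_nilpotent :: "nat \<Rightarrow> ('a, 'b) monoid_scheme \<Rightarrow> bool" where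
  "virtually_step_nilpotent k G \<longleftrightarrow>
     (\<exists>K. subgroup K G \<and> finite (rcosets\<^bsub>G\<^esub> K) \<and> step_nilpotent k (G\<lparr>carrier := K\<rparr>))"

end

theory Submission
  imports Defs Complex_Main "HOL-Library.Function_Algebras" "HOL-Library.Countable_Set"
begin

text \<open>
  Let translations act on maps to the integers modulo \<open>p\<close> that are polynomial of degree at most
  \<open>k\<close>, the argument running over integer sequences. In the semidirect product, commutators are
  finite differences and lower the degree, so term \<open>k\<close> of the lower central series consists of
  constants, which form a normal subgroup of order \<open>p\<close>. Take the countable subgroup generated by the
  constants, the maps \<open>x \<mapsto> x\<^sub>i gchoose k\<close> and the unit translations \<open>e\<^sub>i\<close>. By the pigeonhole
  principle, a subgroup of finite index contains a difference of the maps with indices \<open>i\<close>, \<open>j\<close>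
  and a translation by \<open>e\<^sub>i - e\<^sub>l\<close> with \<open>i\<close>, \<open>j\<close>, \<open>l\<close> distinct. Their \<open>k\<close>-fold iterated commutator
  is the constant \<open>\<plusminus>1\<close>, so the subgroup is not \<open>k\<close>-step nilpotent.
\<close>

section \<open>Commutators and the lower central series\<close>

definition commutator :: "('a, 'b) monoid_scheme \<Rightarrow> 'a \<Rightarrow> 'a \<Rightarrow> 'a" where
  "commutator G x y = x \<otimes>\<^bsub>G\<^esub> y \<otimes>\<^bsub>G\<^esub> inv\<^bsub>G\<^esub> x \<otimes>\<^bsub>G\<^esub> inv\<^bsub>G\<^esub> y"

text \<open>The left-normed commutator \<open>[x, y, ..., y]\<close> with \<open>n\<close> copies of
  \<open>y\<close> (an Engel word). Being nontrivial, it certifies that term \<open>n\<close> of the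
  lower central series is nontrivial.\<close>

primrec iterated_commutator :: "('a, 'b) monoid_scheme \<Rightarrow> 'a \<Rightarrow> 'a \<Rightarrow> nat \<Rightarrow> 'a" where
  "iterated_commutator G x y 0 = x"
| "iterated_commutator G x y (Suc n) = commutator G (iterated_commutator G x y n) y"

text \<open>The generators become an image of a product set, the form that
  \<open>generate_img\<close> and \<open>mono_generate\<close> act on.\<close>

lemma commutator_subgroup_eq:
  "commutator_subgroup G A B = generate G ((\<lambda>(x, y). commutator G x y) ` (A \<times> B))"
  unfolding commutator_subgroup_def commutator_def
  by (rule arg_cong[where f = "generate G"]) auto

context group
begin

lemma commutator_closed [simp]:
  "x \<in> carrier G \<Longrightarrow> y \<in> carrier G \<Longrightarrow> commutator G x y \<in> carrier G"
  by (simp add: commutator_def)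

lemma iterated_commutator_closed [simp]:
  "x \<in> carrier G \<Longrightarrow> y \<in> carrier G \<Longrightarrow> iterated_commutator G x y n \<in> carrier G"
  by (induction n) auto

lemma commutator_subgroup_is_subgroup:
  assumes "A \<subseteq> carrier G" "B \<subseteq> carrier G"
  shows "subgroup (commutator_subgroup G A B) G"
  unfolding commutator_subgroup_eq using assms by (intro generate_is_subgroup) (auto simp: subsetD)

lemma commutator_subgroup_subset:
  assumes "subgroup K G" "\<And>x y. x \<in> A \<Longrightarrow> y \<in> B \<Longrightarrow> commutator G x y \<in> K"
  shows "commutator_subgroup G A B \<subseteq> K"
  unfolding commutator_subgroup_eq
  using assms by (intro generate_subgroup_incl) auto

lemma lower_central_series_subgroup: "subgroup (lower_central_series G n) G"
proof (induction n)
  case 0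
  show ?case by (simp add: subgroup_self)
next
  case (Suc n)
  then show ?case
    by (simp add: commutator_subgroup_is_subgroup subgroup.subset)
qed

lemma iterated_commutator_in_lower_central_series:
  assumes "x \<in> carrier G" "y \<in> carrier G"
  shows "iterated_commutator G x y n \<in> lower_central_series G n"
proof (induction n)
  case 0
  show ?case using assms by simp
next
  case (Suc n)
  then show ?case
    using assms by (auto simp: commutator_subgroup_eq intro!: generate.incl)
qed

end

section \<open>Images of the lower central series under homomorphisms\<close>

context group_hom
begin

lemma hom_commutator:
  "x \<in> carrier G \<Longrightarrow> y \<in> carrier G \<Longrightarrow> h (commutator G x y) = commutator H (h x) (h y)"
  by (simp add: commutator_def)

lemma hom_iterated_commutator:
  "x \<in> carrier G \<Longrightarrow> y \<in> carrier G \<Longrightarrow>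
    h (iterated_commutator G x y n) = iterated_commutator H (h x) (h y) n"
  by (induction n) (auto simp: hom_commutator)

lemma hom_commutator_subgroup:
  assumes "A \<subseteq> carrier G" "B \<subseteq> carrier G"
  shows "h ` commutator_subgroup G A B = commutator_subgroup H (h ` A) (h ` B)"
proof -
  let ?c = "\<lambda>(x, y). commutator G x y"
  have "h ` ?c ` (A \<times> B) = (\<lambda>(x, y). commutator H (h x) (h y)) ` (A \<times> B)"
    unfolding image_image using assms by (intro image_cong) (auto simp: hom_commutator subsetD)
  also have "\<dots> = (\<lambda>(x, y). commutator H x y) ` (h ` A \<times> h ` B)"
    by force
  finally have "h ` ?c ` (A \<times> B) = (\<lambda>(x, y). commutator H x y) ` (h ` A \<times> h ` B)" .
  moreover have "generate H (h ` ?c ` (A \<times> B)) = h ` generate G (?c ` (A \<times> B))"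
    using assms by (intro generate_img) (auto simp: subsetD)
  ultimately show ?thesis
    by (simp add: commutator_subgroup_eq)
qed

text \<open>Only an inclusion, since the image of \<open>G\<close> may be a proper subgroup of
  \<open>H\<close>. It is later applied to the embedding of a subgroup.\<close>

lemma hom_lower_central_series:
  "h ` lower_central_series G n \<subseteq> lower_central_series H n"
proof (induction n)
  case 0
  show ?case by auto
next
  case (Suc n)
  have "h ` lower_central_series G (Suc n) =
      commutator_subgroup H (h ` lower_central_series G n) (h ` carrier G)"
    by (simp add: hom_commutator_subgroup subgroup.subset[OF G.lower_central_series_subgroup])
  also have "\<dots> \<subseteq> lower_central_series H (Suc n)"
    unfolding commutator_subgroup_eq lower_central_series.simps
    using Suc.IH by (intro H.mono_generate image_mono Sigma_mono) auto
  finally show ?case .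
qed

lemma surj_hom_lower_central_series:
  assumes "h ` carrier G = carrier H"
  shows "h ` lower_central_series G n = lower_central_series H n"
  by (induction n)
     (simp_all add: assms hom_commutator_subgroup
        subgroup.subset[OF G.lower_central_series_subgroup])

end

text \<open>The projection is onto, so it maps term \<open>n\<close> onto term \<open>n\<close> of
  the quotient, and it sends every element of \<open>H\<close> to the trivial coset.\<close>

lemma (in normal) step_nilpotent_FactGroup:
  assumes "lower_central_series G n \<subseteq> H"
  shows "step_nilpotent n (G Mod H)"
proof -
  interpret Q: group "G Mod H" by (rule factorgroup_is_group)
  interpret q: group_hom G "G Mod H" "\<lambda>a. H #> a"
    by unfold_locales (rule r_coset_hom_Mod)
  have "lower_central_series (G Mod H) n = (\<lambda>a. H #> a) ` lower_central_series G n"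
    by (rule q.surj_hom_lower_central_series[symmetric]) (auto simp: FactGroup_def RCOSETS_def)
  moreover have "H #> a = H" if "a \<in> lower_central_series G n" for a
    using that assms by (metis coset_join2 mem_carrier subgroup_axioms subsetD)
  moreover have "\<one> \<in> lower_central_series G n"
    using lower_central_series_subgroup subgroup.one_closed by blast
  ultimately have "lower_central_series (G Mod H) n = {H}"
    by auto
  then show ?thesis
    using Q.is_group by (simp add: step_nilpotent_def FactGroup_def)
qed

section \<open>Subgroups of finite index\<close>

lemma (in group) subgroup_group_hom:
  assumes "subgroup K G"
  shows "group_hom (G\<lparr>carrier := K\<rparr>) G (\<lambda>x. x)"
proof -
  interpret K: group "G\<lparr>carrier := K\<rparr>"
    using assms by (rule subgroup_imp_group)
  show ?thesis
    by unfold_locales (use subgroup.subset[OF assms] in \<open>auto simp: hom_def\<close>)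
qed

text \<open>By the pigeonhole principle both quotients land in any \<open>K\<close> of finite index
  for suitable indices; their iterated commutator is then in term \<open>n\<close> of the series of
  \<open>K\<close>.\<close>

lemma (in group) not_virtually_step_nilpotent:
  fixes f e :: "nat \<Rightarrow> 'a"
  assumes carrier: "\<And>i. f i \<in> carrier G" "\<And>i. e i \<in> carrier G"
    and nontrivial: "\<And>i j l. i \<noteq> j \<Longrightarrow> i \<noteq> l \<Longrightarrow> j \<noteq> l \<Longrightarrow>
      iterated_commutator G (f i \<otimes> inv f j) (e i \<otimes> inv e l) n \<noteq> \<one>"
  shows "\<not> virtually_step_nilpotent n G"
proof
  assume "virtually_step_nilpotent n G"
  then obtain K where K: "subgroup K G" "finite (rcosets K)"
    and nil: "lower_central_series (G\<lparr>carrier := K\<rparr>) n = {\<one>}"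
    by (auto simp: virtually_step_nilpotent_def step_nilpotent_def)
  interpret K: group_hom "G\<lparr>carrier := K\<rparr>" G "\<lambda>x. x"
    using K(1) by (rule subgroup_group_hom)
  \<comment> \<open>Pairs of cosets are recorded so that one choice of indices serves
    \<open>f\<close> and \<open>e\<close> at once.\<close>
  define c where "c i = (K #> f i, K #> e i)" for i
  have "range c \<subseteq> (rcosets K) \<times> (rcosets K)"
    using carrier subgroup.subset[OF K(1)] by (auto simp: c_def intro!: rcosetsI)
  then have "finite (range c)"
    using K(2) finite_subset by blast
  then obtain i0 where "infinite {i. c i = c i0}"
    using pigeonhole_infinite[of "UNIV :: nat set" c] by auto
  \<comment> \<open>The two quotients share the index \<open>i\<close> but not the second one, hence
    three members of one fibre.\<close>
  then obtain A where "A \<subseteq> {i. c i = c i0}" "finite A" "card A = 3"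
    using infinite_arbitrarily_large by blast
  then obtain i j l where ijl: "i \<noteq> j" "i \<noteq> l" "j \<noteq> l" "c i = c i0" "c j = c i0" "c l = c i0"
    by (auto simp: card_3_iff)
  have quotient: "x \<otimes> inv y \<in> K"
    if "x \<in> carrier G" "y \<in> carrier G" "K #> x = K #> y" for x y
    using that subgroup.rcos_module_imp[OF K(1) is_group] rcos_self K(1) by metis
  define u t where "u = f i \<otimes> inv f j" and "t = e i \<otimes> inv e l"
  have "u \<in> K" "t \<in> K"
    using ijl carrier by (auto simp: u_def t_def c_def intro!: quotient)
  then have "iterated_commutator G u t n \<in> {\<one>}"
    unfolding nil[symmetric]
    using K.G.iterated_commutator_in_lower_central_series[of u t n]
      K.hom_iterated_commutator[of u t n] by simp
  then show False
    using nontrivial ijl by (simp add: u_def t_def)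
qed

section \<open>Countable groups and their copies on the natural numbers\<close>

lemma (in group) countable_generate:
  assumes "countable S"
  shows "countable (generate G S)"
proof -
  define T where "T = S \<union> (\<lambda>x. inv x) ` S"
  \<comment> \<open>Countable stages: each adds the generators, their inverses and all products of
    two elements of the previous stage.\<close>
  define A where "A = rec_nat {\<one>} (\<lambda>_ B. B \<union> T \<union> (\<lambda>(x, y). x \<otimes> y) ` (B \<times> B))"
  have A_0: "A 0 = {\<one>}" and A_Suc: "A (Suc n) = A n \<union> T \<union> (\<lambda>(x, y). x \<otimes> y) ` (A n \<times> A n)" for n
    by (simp_all add: A_def)
  have "countable (A n)" for n
    by (induction n) (auto simp: A_0 A_Suc T_def assms)
  then have "countable (\<Union>n. A n)" by blast
  moreover have "generate G S \<subseteq> (\<Union>n. A n)"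
  proof
    fix x assume "x \<in> generate G S"
    then show "x \<in> (\<Union>n. A n)"
    proof induction
      case one
      then show ?case using A_0 by blast
    next
      case (incl x)
      then show ?case using A_Suc[of 0] by (auto simp: T_def)
    next
      case (inv x)
      then show ?case using A_Suc[of 0] by (auto simp: T_def)
    next
      case (eng x y)
      then obtain m n where mn: "x \<in> A m" "y \<in> A n" by blast
      \<comment> \<open>The stages increase, so both factors lie in a common stage and their product
        in the next one.\<close>
      have "mono A"
        by (rule mono_iff_le_Suc[THEN iffD2]) (auto simp: A_Suc)
      then have "x \<in> A (max m n)" "y \<in> A (max m n)"
        using mn by (meson max.cobounded1 max.cobounded2 monoD subsetD)+
      then have "x \<otimes> y \<in> A (Suc (max m n))"
        by (auto simp: A_Suc)
      then show ?case by blast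
    qed
  qed
  ultimately show ?thesis
    by (rule countable_subset[rotated])
qed

text \<open>Transport of structure along an enumeration; it brings the example, built from
  functions, to the type \<open>nat\<close>.\<close>

lemma (in group) countable_iso_nat:
  assumes "countable (carrier G)"
  obtains N :: "nat monoid" and h where "group N" "h \<in> iso G N"
proof -
  define h where "h = to_nat_on (carrier G)"
  have inj: "inj_on h (carrier G)"
    using assms by (simp add: h_def inj_on_to_nat_on)
  define g where "g = inv_into (carrier G) h"
  define N where "N = \<lparr>carrier = h ` carrier G, monoid.mult = (\<lambda>a b. h (g a \<otimes> g b)), one = h \<one>\<rparr>"
  have "h \<in> iso G N"
    using inj by (auto simp: iso_def hom_def bij_betw_def N_def g_def)
  \<comment> \<open>\<open>iso_imp_img_group\<close> resets the unit to the image of the unit, which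
    \<open>N\<close> already has.\<close>
  moreover from this have "group (N\<lparr>one := h \<one>\<rparr>)"
    by (rule iso_imp_img_group)
  then have "group N" by (simp add: N_def)
  ultimately show ?thesis using that by blast
qed

section \<open>Finite differences and degree modulo \<open>p\<close>\<close>

text \<open>Polynomial maps modulo \<open>p\<close> of degree at most \<open>d\<close>, via vanishing finite differences.\<close>

primrec poly_deg :: "int \<Rightarrow> nat \<Rightarrow> ('b::ab_group_add \<Rightarrow> int) \<Rightarrow> bool" where
  "poly_deg p 0 f \<longleftrightarrow> (\<forall>x. f x mod p = f 0 mod p)"
| "poly_deg p (Suc d) f \<longleftrightarrow> (\<forall>b. poly_deg p d (\<lambda>x. f (x + b) - f x))"

text \<open>Finite differences respect congruence, so the degree depends on residues only. This
  permits storing group elements as reduced functions.\<close>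

lemma poly_deg_cong:
  assumes "\<And>x. f x mod p = g x mod p"
  shows "poly_deg p d f \<longleftrightarrow> poly_deg p d g"
  using assms
proof (induction d arbitrary: f g)
  case 0
  then show ?case by simp
next
  case (Suc d)
  have "poly_deg p d (\<lambda>x. f (x + b) - f x) \<longleftrightarrow> poly_deg p d (\<lambda>x. g (x + b) - g x)" for b
    by (rule Suc.IH) (intro mod_diff_cong Suc.prems)
  then show ?case by simp
qed

lemma poly_deg_mod [simp]: "poly_deg p d (\<lambda>x. f x mod p) \<longleftrightarrow> poly_deg p d f"
  by (rule poly_deg_cong) simp

lemma poly_deg_const [simp]: "poly_deg p d (\<lambda>_. c)"
  by (induction d arbitrary: c) auto

lemma poly_deg_add:
  "poly_deg p d f \<Longrightarrow> poly_deg p d g \<Longrightarrow> poly_deg p d (\<lambda>x. f x + g x)"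
proof (induction d arbitrary: f g)
  case 0
  then show ?case unfolding poly_deg.simps(1) by (blast intro: mod_add_cong)
next
  case (Suc d)
  have "poly_deg p d (\<lambda>x. (f (x + b) - f x) + (g (x + b) - g x))" for b
    using Suc by simp
  then show ?case by (simp add: algebra_simps)
qed

lemma poly_deg_uminus:
  "poly_deg p d f \<Longrightarrow> poly_deg p d (\<lambda>x. - f x)"
proof (induction d arbitrary: f)
  case 0
  then show ?case unfolding poly_deg.simps(1) by (blast intro: mod_minus_cong)
next
  case (Suc d)
  have "poly_deg p d (\<lambda>x. - (f (x + b) - f x))" for b
    using Suc by (simp del: minus_diff_eq)
  then show ?case by (simp add: algebra_simps)
qed

lemma poly_deg_diff:
  "poly_deg p d f \<Longrightarrow> poly_deg p d g \<Longrightarrow> poly_deg p d (\<lambda>x. f x - g x)"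
  using poly_deg_add[of p d f "\<lambda>x. - g x"] poly_deg_uminus[of p d g] by simp

lemma poly_deg_shift:
  "poly_deg p d f \<Longrightarrow> poly_deg p d (\<lambda>x. f (x + c))"
proof (induction d arbitrary: f)
  case 0
  then show ?case by (metis poly_deg.simps(1))
next
  case (Suc d)
  have "poly_deg p d (\<lambda>x. f (x + c + b) - f (x + c))" for b
    using Suc.IH[of "\<lambda>x. f (x + b) - f x"] Suc.prems by simp
  then show ?case by (simp add: algebra_simps)
qed

lemma poly_deg_difference:
  assumes "poly_deg p d f"
  shows "poly_deg p (d - 1) (\<lambda>x. f (x + b) - f x)"
proof (cases d)
  \<comment> \<open>Here \<open>d - 1\<close> is again \<open>0\<close>: the difference of a
    constant vanishes modulo \<open>p\<close>, so it is constant too.\<close>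
  case 0
  have "f (x + b) mod p = f x mod p" for x
    using assms 0 by (metis poly_deg.simps(1))
  then have "(f (x + b) - f x) mod p = 0" for x
    unfolding mod_eq_dvd_iff by (rule dvd_imp_mod_0)
  then have "poly_deg p 0 (\<lambda>x. f (x + b) - f x)"
    by (simp only: poly_deg.simps(1) simp_thms)
  then show ?thesis using 0 by simp
next
  case (Suc e)
  then show ?thesis using assms by simp
qed

text \<open>An additive \<open>a\<close> turns the increment \<open>b\<close> into the increment
  \<open>a b\<close>. The case needed is a coordinate projection.\<close>

lemma poly_deg_compose_additive:
  assumes "\<And>x y. a (x + y) = a x + a y"
  shows "poly_deg p d f \<Longrightarrow> poly_deg p d (\<lambda>x. f (a x))"
proof (induction d arbitrary: f)
  case 0
  then show ?case by (metis poly_deg.simps(1))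
next
  case (Suc d)
  have "poly_deg p d (\<lambda>x. f (a x + a b) - f (a x))" for b
    using Suc.IH[of "\<lambda>x. f (x + a b) - f x"] Suc.prems by simp
  then show ?case by (simp add: assms)
qed

section \<open>Binomial coefficients at integer arguments\<close>

text \<open>This is \<open>x gchoose k\<close>, whose type constraint excludes \<^typ>\<open>int\<close> here.\<close>

definition int_binomial :: "int \<Rightarrow> nat \<Rightarrow> int" where
  "int_binomial x k = (- 1) ^ k * pochhammer (- x) k div fact k"

lemma int_binomial_0 [simp]: "int_binomial x 0 = 1"
  by (simp add: int_binomial_def)

lemma int_binomial_Suc_Suc:
  "int_binomial (x + 1) (Suc k) = int_binomial x k + int_binomial x (Suc k)"
  unfolding int_binomial_def
  using gbinomial_int_Suc_Suc[unfolded gbinomial_int_pochhammer] .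

text \<open>By Pascal's rule the unit difference is the binomial one degree lower.
  \<open>poly_deg\<close> asks for every increment \<open>m\<close>, hence an induction in both
  directions, each step adding or subtracting a translated binomial of degree
  \<open>d\<close>.\<close>

lemma poly_deg_int_binomial: "poly_deg p d (\<lambda>x. int_binomial x d)"
proof (induction d)
  case 0
  show ?case by simp
next
  case (Suc d)
  have "poly_deg p d (\<lambda>x. int_binomial (x + m) (Suc d) - int_binomial x (Suc d))" for m
  proof (induction m rule: int_induct[where k = 0])
    case base
    show ?case by simp
  next
    case (step1 m)
    have "poly_deg p d (\<lambda>x. int_binomial (x + m) d
        + (int_binomial (x + m) (Suc d) - int_binomial x (Suc d)))"
      by (intro poly_deg_add step1.IH poly_deg_shift[OF Suc.IH])
    moreover have "int_binomial (x + (m + 1)) (Suc d)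
        = int_binomial (x + m) d + int_binomial (x + m) (Suc d)" for x
      using int_binomial_Suc_Suc[of "x + m" d] by (simp add: add.assoc)
    ultimately show ?case by (simp add: algebra_simps)
  next
    case (step2 m)
    have "poly_deg p d
        (\<lambda>x. (int_binomial (x + m) (Suc d) - int_binomial x (Suc d)) - int_binomial (x + (m - 1)) d)"
      by (intro poly_deg_diff step2.IH poly_deg_shift[OF Suc.IH])
    moreover have "int_binomial (x + m) (Suc d)
        = int_binomial (x + (m - 1)) d + int_binomial (x + (m - 1)) (Suc d)" for x
      using int_binomial_Suc_Suc[of "x + (m - 1)" d] by (simp add: add.assoc)
    ultimately show ?case by (simp add: algebra_simps)
  qed
  then show ?case by simp
qed

section \<open>The semidirect product and its lower central series\<close>

text \<open>The semidirect product of the polynomial maps of degree at most \<open>d\<close>, with values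
  represented by residues modulo \<open>p\<close>, by the group of translations.\<close>

definition poly_group :: "int \<Rightarrow> nat \<Rightarrow> (('b::ab_group_add \<Rightarrow> int) \<times> 'b) monoid" where
  "poly_group p d =
    \<lparr>carrier = {(f, b). (\<forall>x. f x mod p = f x) \<and> poly_deg p d f},
     monoid.mult = (\<lambda>(f, b) (g, c). (\<lambda>x. (f x + g (x + b)) mod p, b + c)),
     one = (\<lambda>_. 0, 0)\<rparr>"

lemma carrier_poly_group:
  "(f, b) \<in> carrier (poly_group p d) \<longleftrightarrow> (\<forall>x. f x mod p = f x) \<and> poly_deg p d f"
  by (simp add: poly_group_def)

lemma mult_poly_group:
  "(f, b) \<otimes>\<^bsub>poly_group p d\<^esub> (g, c) = (\<lambda>x. (f x + g (x + b)) mod p, b + c)"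
  by (simp add: poly_group_def)

lemma one_poly_group: "\<one>\<^bsub>poly_group p d\<^esub> = (\<lambda>_. 0, 0)"
  by (simp add: poly_group_def)

lemma poly_group_is_group: "group (poly_group p d)" (is "group ?P")
proof (rule groupI)
  fix x y assume "x \<in> carrier ?P" "y \<in> carrier ?P"
  then show "x \<otimes>\<^bsub>?P\<^esub> y \<in> carrier ?P"
    by (cases x; cases y)
       (simp add: carrier_poly_group mult_poly_group poly_deg_add poly_deg_shift)
next
  show "\<one>\<^bsub>?P\<^esub> \<in> carrier ?P"
    by (simp add: carrier_poly_group one_poly_group)
next
  fix x y z assume "x \<in> carrier ?P" "y \<in> carrier ?P"
    "z \<in> carrier ?P"
  then show "x \<otimes>\<^bsub>?P\<^esub> y \<otimes>\<^bsub>?P\<^esub> z =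
      x \<otimes>\<^bsub>?P\<^esub> (y \<otimes>\<^bsub>?P\<^esub> z)"
    by (cases x; cases y; cases z) (simp add: mult_poly_group mod_simps add.assoc)
next
  fix x assume "x \<in> carrier ?P"
  then show "\<one>\<^bsub>?P\<^esub> \<otimes>\<^bsub>?P\<^esub> x = x"
    by (cases x) (simp add: mult_poly_group one_poly_group carrier_poly_group)
next
  fix x assume x: "x \<in> carrier ?P"
  obtain f b where fb: "x = (f, b)" by fastforce
  let ?y = "(\<lambda>x. - f (x + - b) mod p, - b)"
  have "?y \<in> carrier ?P"
    using x poly_deg_uminus[OF poly_deg_shift[of p d f "- b"]]
    unfolding carrier_poly_group fb poly_deg_mod by simp
  moreover have "?y \<otimes>\<^bsub>?P\<^esub> x = \<one>\<^bsub>?P\<^esub>"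
    by (simp add: fb mult_poly_group one_poly_group mod_simps)
  ultimately show "\<exists>y \<in> carrier ?P. y \<otimes>\<^bsub>?P\<^esub> x = \<one>\<^bsub>?P\<^esub>"
    by blast
qed

interpretation poly_group: group "poly_group p d"
  by (rule poly_group_is_group)

lemma inv_poly_group:
  assumes "(f, b) \<in> carrier (poly_group p d)"
  shows "inv\<^bsub>poly_group p d\<^esub> (f, b) = (\<lambda>x. - f (x - b) mod p, - b)"
proof (rule poly_group.inv_equality)
  show "(\<lambda>x. - f (x - b) mod p, - b) \<in> carrier (poly_group p d)"
    using assms poly_deg_uminus[OF poly_deg_shift[of p d f "- b"]]
    unfolding carrier_poly_group poly_deg_mod by simp
qed (use assms in \<open>simp_all add: mult_poly_group one_poly_group mod_simps\<close>)

text \<open>Multiplied in either order, the two elements have the same translation part, so only the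
  difference of the function parts survives: two finite differences, which lower the degree.\<close>

lemma commutator_poly_group:
  assumes "(f, b) \<in> carrier (poly_group p d)" "(g, c) \<in> carrier (poly_group p d)"
  shows "commutator (poly_group p d) (f, b) (g, c) =
    (\<lambda>x. ((g (x + b) - g x) - (f (x + c) - f x)) mod p, 0)"
  using assms
  by (simp add: commutator_def inv_poly_group mult_poly_group mod_simps) (simp add: algebra_simps)

definition poly_part :: "int \<Rightarrow> nat \<Rightarrow> nat \<Rightarrow> (('b::ab_group_add \<Rightarrow> int) \<times> 'b) set" where
  "poly_part p d e = {(f, b) \<in> carrier (poly_group p d). poly_deg p e f \<and> b = 0}"

lemma poly_part_subgroup: "subgroup (poly_part p d e) (poly_group p d)"
  (is "subgroup ?Q ?P")
proof (rule poly_group.subgroupI)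
  show "?Q \<subseteq> carrier ?P"
    by (auto simp: poly_part_def)
  have "(\<lambda>_. 0, 0) \<in> ?Q"
    by (simp add: poly_part_def carrier_poly_group)
  then show "?Q \<noteq> {}" by blast
next
  fix x assume "x \<in> ?Q"
  then obtain f where f: "x = (f, 0)" "(f, 0) \<in> carrier ?P" "poly_deg p e f"
    by (auto simp: poly_part_def)
  then show "inv\<^bsub>?P\<^esub> x \<in> ?Q"
    using poly_group.inv_closed[OF f(2)] by (simp add: poly_part_def inv_poly_group poly_deg_uminus)
next
  fix x y assume "x \<in> ?Q" "y \<in> ?Q"
  then obtain f g where fg: "x = (f, 0)" "(f, 0) \<in> carrier ?P" "poly_deg p e f"
    "y = (g, 0)" "(g, 0) \<in> carrier ?P" "poly_deg p e g"
    by (auto simp: poly_part_def)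
  then show "x \<otimes>\<^bsub>?P\<^esub> y \<in> ?Q"
    using poly_group.m_closed[OF fg(2,5)]
    by (simp add: poly_part_def mult_poly_group poly_deg_add)
qed

text \<open>The first commutator removes the translation part and one degree; each later one removes
  a further degree. At \<open>n = d\<close> only constants remain.\<close>

lemma lower_central_series_poly_group:
  "lower_central_series (poly_group p (Suc d)) (Suc n) \<subseteq> poly_part p (Suc d) (d - n)"
proof (induction n)
  case 0
  have "commutator (poly_group p (Suc d)) x y \<in> poly_part p (Suc d) d"
    if xy: "x \<in> carrier (poly_group p (Suc d))" "y \<in> carrier (poly_group p (Suc d))"
    for x y :: "('a \<Rightarrow> int) \<times> 'a"
  proof -
    obtain f b g c where [simp]: "x = (f, b)" "y = (g, c)" by fastforce
    have "poly_deg p d (\<lambda>x. (g (x + b) - g x) - (f (x + c) - f x))"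
      by (rule poly_deg_diff) (use xy in \<open>auto simp: carrier_poly_group\<close>)
    then show ?thesis
      using xy poly_group.commutator_closed[OF xy]
      by (simp add: commutator_poly_group poly_part_def)
  qed
  then show ?case
    unfolding lower_central_series.simps diff_zero
    by (rule poly_group.commutator_subgroup_subset[OF poly_part_subgroup])
next
  case (Suc n)
  have "commutator (poly_group p (Suc d)) x y \<in> poly_part p (Suc d) (d - Suc n)"
    if x: "x \<in> lower_central_series (poly_group p (Suc d)) (Suc n)"
      and y: "y \<in> carrier (poly_group p (Suc d))"
    for x y :: "('a \<Rightarrow> int) \<times> 'a"
  proof -
    obtain f g c where [simp]: "x = (f, 0)" "y = (g, c)"
      and f: "(f, 0) \<in> carrier (poly_group p (Suc d))" "poly_deg p (d - n) f"
      using subsetD[OF Suc.IH x] by (cases y) (auto simp: poly_part_def)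
    \<comment> \<open>As \<open>x\<close> has no translation part, the difference of
      \<open>g\<close> vanishes and only that of \<open>f\<close> is left.\<close>
    have "poly_deg p (d - Suc n) (\<lambda>x. - (f (x + c) - f x))"
      using poly_deg_uminus[OF poly_deg_difference[OF f(2)]] by simp
    then show ?thesis
      using f y poly_group.commutator_closed[OF f(1), of y]
      by (simp add: commutator_poly_group poly_part_def)
  qed
  then show ?case
    unfolding lower_central_series.simps(2)[of _ "Suc n"]
    by (rule poly_group.commutator_subgroup_subset[OF poly_part_subgroup])
qed

lemma poly_part_0:
  assumes "0 < p"
  shows "poly_part p d 0 = (\<lambda>c. (\<lambda>_. c, 0)) ` {0..<p}"
proof (intro equalityI subsetI)
  fix x assume "x \<in> poly_part p d 0"
  then obtain f where f: "x = (f, 0)" "\<And>y. f y mod p = f y" "\<And>y. f y mod p = f 0 mod p"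
    by (auto simp: poly_part_def carrier_poly_group)
  have "f = (\<lambda>_. f 0)"
    by (rule ext) (metis f(2,3))
  then have "x = (\<lambda>_. f 0, 0)"
    using f(1) by simp
  moreover have "f 0 \<in> {0..<p}"
    using f(2)[of 0] assms by (metis atLeastLessThan_iff pos_mod_bound pos_mod_sign)
  ultimately show "x \<in> (\<lambda>c. (\<lambda>_. c, 0)) ` {0..<p}" by blast
qed (auto simp: poly_part_def carrier_poly_group)

text \<open>Constants are invariant under translation and addition of functions is commutative, so
  these elements are even central.\<close>

lemma poly_part_0_normal: "poly_part p d 0 \<lhd> poly_group p d" (is "?Q \<lhd> ?P")
proof (rule poly_group.normal_invI[OF poly_part_subgroup])
  fix x h assume x: "x \<in> carrier ?P" and h: "h \<in> ?Q"
  obtain f b where [simp]: "x = (f, b)" by fastforce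
  obtain g where "h = (g, 0)" "\<And>y. g y mod p = g y" "\<And>y. g y mod p = g 0 mod p"
    using h by (auto simp: poly_part_def carrier_poly_group)
  moreover from this have "g = (\<lambda>_. g 0)" by (intro ext) metis
  ultimately obtain c where [simp]: "h = (\<lambda>_. c, 0)" and c: "c mod p = c" by metis
  have "x \<otimes>\<^bsub>?P\<^esub> h \<otimes>\<^bsub>?P\<^esub> inv\<^bsub>?P\<^esub> x = h"
    using x c by (simp add: inv_poly_group mult_poly_group mod_simps)
  then show "x \<otimes>\<^bsub>?P\<^esub> h \<otimes>\<^bsub>?P\<^esub> inv\<^bsub>?P\<^esub> x \<in> ?Q"
    using h by simp
qed

text \<open>Each commutator with a pure translation applies the negated difference operator, whence
  the sign.\<close>

lemma iterated_commutator_poly_group: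
  assumes "poly_deg p d f"
  shows "iterated_commutator (poly_group p d) (\<lambda>x. f x mod p, 0) (\<lambda>_. 0, c) n =
    (\<lambda>x. ((- 1) ^ n * (((\<lambda>g x. g (x + c) - g x) ^^ n) f) x) mod p, 0)"
proof (induction n)
  case 0
  show ?case by simp
next
  case (Suc n)
  let ?u = "iterated_commutator (poly_group p d) (\<lambda>x. f x mod p, 0) (\<lambda>_. 0, c) n"
  have "(\<lambda>x. f x mod p, 0) \<in> carrier (poly_group p d)" "(\<lambda>_. 0, c) \<in> carrier (poly_group p d)"
    using assms by (auto simp: carrier_poly_group)
  then have "?u \<in> carrier (poly_group p d)" "(\<lambda>_. 0, c) \<in> carrier (poly_group p d)"
    by auto
  then show ?case
    unfolding Suc.IH iterated_commutator.simps
    by (simp add: commutator_poly_group mod_simps algebra_simps)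
qed

section \<open>The countable example and its nonvanishing commutators\<close>

theorem proposition7p5:
  fixes k p :: nat
  assumes "k \<ge> 1" and "Factorial_Ring.prime p" and "odd p"
  shows "\<exists>(G :: nat monoid) H. Group.group G \<and> H \<lhd> G \<and> finite H \<and> card H = p \<and>
           step_nilpotent k (G Mod H) \<and> \<not> virtually_step_nilpotent k G"
proof -
  obtain d where k: "k = Suc d"
    using assms(1) by (cases k) auto
  have p: "1 < p" using assms(2) by (rule prime_gt_1_nat)
  \<comment> \<open>Infinitely many coordinates supply the indices for the pigeonhole
    argument.\<close>
  let ?P = "poly_group (int p) k :: (((nat \<Rightarrow> int) \<Rightarrow> int) \<times> (nat \<Rightarrow> int)) monoid"
  define Z where "Z = (poly_part (int p) k 0 :: (((nat \<Rightarrow> int) \<Rightarrow> int) \<times> (nat \<Rightarrow> int)) set)"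
  define \<delta> :: "nat \<Rightarrow> nat \<Rightarrow> int" where "\<delta> i j = (if j = i then 1 else 0)" for i j
  \<comment> \<open>Binomials instead of powers: the difference of order \<open>k\<close> of the
    power \<open>k\<close> is \<open>k!\<close>, which vanishes modulo \<open>p\<close> if
    \<open>p \<le> k\<close>, while the binomial gives \<open>1\<close>.\<close>
  define F :: "nat \<Rightarrow> ((nat \<Rightarrow> int) \<Rightarrow> int) \<times> (nat \<Rightarrow> int)"
    where "F i = (\<lambda>x. int_binomial (x i) k mod int p, 0)" for i
  define E :: "nat \<Rightarrow> ((nat \<Rightarrow> int) \<Rightarrow> int) \<times> (nat \<Rightarrow> int)"
    where "E i = (\<lambda>_. 0, \<delta> i)" for i
  \<comment> \<open>The constants are among the generators so that all \<open>p\<close> of them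
    belong to \<open>C\<close>.\<close>
  define C where "C = generate ?P (range F \<union> range E \<union> Z)"
  define G where "G = ?P\<lparr>carrier := C\<rparr>"

  have Z_eq: "Z = (\<lambda>c. (\<lambda>_. c, 0)) ` {0..<int p}"
    using p by (simp add: Z_def poly_part_0)
  have "inj_on (\<lambda>c :: int. (\<lambda>_ :: nat \<Rightarrow> int. c, 0 :: nat \<Rightarrow> int)) {0..<int p}"
    by (rule inj_onI) (auto dest: fun_cong)
  then have Z_card: "finite Z" "card Z = p"
    by (simp_all add: Z_eq card_image)

  have deg: "poly_deg (int p) k (\<lambda>x :: nat \<Rightarrow> int. int_binomial (x i) k)" for i
    by (rule poly_deg_compose_additive[OF _ poly_deg_int_binomial, of "\<lambda>x. x i"]) simp
  have F: "F i \<in> carrier ?P" for i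
    using deg by (simp add: F_def carrier_poly_group)
  have E: "E i \<in> carrier ?P" for i
    by (simp add: E_def carrier_poly_group)
  have gens: "range F \<union> range E \<union> Z \<subseteq> carrier ?P"
    using F E by (auto simp: Z_def poly_part_def)
  then have C: "subgroup C ?P"
    unfolding C_def by (rule poly_group.generate_is_subgroup)
  have F_C: "F i \<in> C" and E_C: "E i \<in> C" and Z_C: "Z \<subseteq> C" for i
    by (auto simp: C_def intro: generate.incl)
  interpret inc: group_hom G ?P "\<lambda>x. x"
    unfolding G_def using C by (rule poly_group.subgroup_group_hom)
  \<comment> \<open>For an inclusion map these rules would rewrite the operations of
    \<open>G\<close> into those of \<open>?P\<close>.\<close>
  note [simp del] = inc.hom_one inc.hom_mult inc.hom_inv
  have quotient: "x \<otimes>\<^bsub>G\<^esub> inv\<^bsub>G\<^esub> y = x \<otimes>\<^bsub>?P\<^esub> inv\<^bsub>?P\<^esub> y"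
    if "x \<in> carrier G" "y \<in> carrier G" for x y
    using that by (metis inc.G.inv_closed inc.hom_inv inc.hom_mult)
  have "countable C"
    unfolding C_def using Z_card(1)
    by (intro poly_group.countable_generate) (auto intro: countable_finite)
  then obtain N :: "nat monoid" and h where N: "group N" and iso: "h \<in> iso G N"
    using inc.G.countable_iso_nat by (auto simp: G_def)
  interpret N: group N by (rule N)
  interpret h: group_hom G N h
    using iso by unfold_locales (simp add: iso_def)
  have h_surj: "h ` carrier G = carrier N" and h_inj: "inj_on h (carrier G)"
    using iso by (auto simp: iso_def bij_betw_def)

  have "Z \<lhd> G"
    unfolding G_def Z_def
    by (rule poly_group.normal_restrict_supergroup[OF C poly_part_0_normal])
       (use Z_C in \<open>simp add: Z_def\<close>)
  then have normal: "h ` Z \<lhd> N"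
    using iso inc.G.is_group N by (metis iso_normal_subgroup)
  have "card (h ` Z) = card Z"
    using h_inj Z_C by (intro card_image) (auto simp: G_def intro: inj_on_subset)
  moreover have "lower_central_series N k \<subseteq> h ` Z"
  proof -
    have "lower_central_series G k \<subseteq> lower_central_series ?P k"
      using inc.hom_lower_central_series[of k] by simp
    also have "\<dots> \<subseteq> Z"
      using lower_central_series_poly_group[of "int p" d d] by (simp add: k Z_def)
    finally show ?thesis
      using h.surj_hom_lower_central_series[OF h_surj, of k] by blast
  qed
  then have "step_nilpotent k (N Mod h ` Z)"
    by (rule normal.step_nilpotent_FactGroup[OF normal])
  moreover have "\<not> virtually_step_nilpotent k N"
  proof (rule N.not_virtually_step_nilpotent[of "\<lambda>i. h (F i)" "\<lambda>i. h (E i)"])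
    have FG: "F i \<in> carrier G" and EG: "E i \<in> carrier G" for i
      using F_C E_C by (auto simp: G_def)
    then show "h (F i) \<in> carrier N" "h (E i) \<in> carrier N" for i
      by auto
    fix i j l :: nat assume ijl: "i \<noteq> j" "i \<noteq> l" "j \<noteq> l"
    define f :: "(nat \<Rightarrow> int) \<Rightarrow> int" where "f x = int_binomial (x i) k - int_binomial (x j) k" for x
    define u t where "u = F i \<otimes>\<^bsub>G\<^esub> inv\<^bsub>G\<^esub> F j" and "t = E i \<otimes>\<^bsub>G\<^esub> inv\<^bsub>G\<^esub> E l"
    have uG: "u \<in> carrier G" and tG: "t \<in> carrier G"
      using FG EG by (auto simp: u_def t_def)
    have "u = F i \<otimes>\<^bsub>?P\<^esub> inv\<^bsub>?P\<^esub> F j"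
      unfolding u_def by (rule quotient[OF FG FG])
    also have "\<dots> = (\<lambda>x. f x mod int p, 0)"
      using F[of j] unfolding F_def by (simp add: inv_poly_group mult_poly_group mod_simps f_def)
    finally have u: "u = (\<lambda>x. f x mod int p, 0)" .
    have "t = E i \<otimes>\<^bsub>?P\<^esub> inv\<^bsub>?P\<^esub> E l"
      unfolding t_def by (rule quotient[OF EG EG])
    also have "\<dots> = (\<lambda>_. 0, \<delta> i - \<delta> l)"
      using E[of l] unfolding E_def by (simp add: inv_poly_group mult_poly_group)
    finally have t: "t = (\<lambda>_. 0, \<delta> i - \<delta> l)" .
    let ?D = "\<lambda>g x. g (x + (\<delta> i - \<delta> l)) - g x"
    \<comment> \<open>The increment raises coordinate \<open>i\<close> by one and fixes coordinate
      \<open>j\<close>, as \<open>j\<close> differs from \<open>i\<close> and \<open>l\<close>. So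
      the first difference cancels the binomial in \<open>x j\<close>, and Pascal's rule lowers the
      other one at every step.\<close>
    have "(?D ^^ Suc n) f = (\<lambda>x. int_binomial (x i) (d - n))" if "n \<le> d" for n
      using that
    proof (induction n)
      case 0
      show ?case
        using ijl by (simp add: f_def k \<delta>_def int_binomial_Suc_Suc)
    next
      case (Suc n)
      then obtain e where e: "d - n = Suc e" "d - Suc n = e"
        by (metis Suc_diff_Suc Suc_le_lessD)
      have IH: "(?D ^^ Suc n) f = (\<lambda>x. int_binomial (x i) (Suc e))"
        unfolding e(1)[symmetric] by (rule Suc.IH) (use Suc.prems in simp)
      have "(?D ^^ Suc (Suc n)) f = ?D ((?D ^^ Suc n) f)" by simp
      also have "\<dots> = ?D (\<lambda>x. int_binomial (x i) (Suc e))"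
        by (simp only: IH)
      also have "\<dots> = (\<lambda>x. int_binomial (x i) (d - Suc n))"
        using ijl e by (simp add: \<delta>_def int_binomial_Suc_Suc)
      finally show ?case .
    qed
    from this[of d] have D: "(?D ^^ k) f = (\<lambda>_. 1)"
      by (simp add: k)
    have "poly_deg (int p) k f"
      unfolding f_def by (intro poly_deg_diff deg)
    then have comm: "iterated_commutator ?P u t k = (\<lambda>_. (- 1) ^ k mod int p, 0)"
      unfolding u t by (subst iterated_commutator_poly_group) (simp_all add: D)
    \<comment> \<open>The square of this sign is \<open>1\<close>, so divisibility by
      \<open>p\<close> would make \<open>p\<close> a divisor of \<open>1\<close>.\<close>
    have "(- 1) ^ k mod int p \<noteq> 0"
    proof
      assume "(- 1) ^ k mod int p = 0"
      then have "int p dvd (- 1) ^ k" by (simp add: dvd_eq_mod_eq_0)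
      then have "int p dvd (- 1) ^ k * (- 1) ^ k" by (rule dvd_mult2)
      then have "int p dvd 1" by (simp flip: power_mult_distrib)
      then show False using p by simp
    qed
    then have "iterated_commutator ?P u t k \<noteq> \<one>\<^bsub>?P\<^esub>"
      by (auto simp: comm one_poly_group dest: fun_cong)
    then have "iterated_commutator G u t k \<noteq> \<one>\<^bsub>G\<^esub>"
      using inc.hom_iterated_commutator[OF uG tG, of k] by (simp add: G_def)
    then have "h (iterated_commutator G u t k) \<noteq> \<one>\<^bsub>N\<^esub>"
      using h_inj uG tG
      by (metis h.hom_one inc.G.iterated_commutator_closed inc.G.one_closed inj_on_eq_iff)
    moreover have "h u = h (F i) \<otimes>\<^bsub>N\<^esub> inv\<^bsub>N\<^esub> h (F j)" "h t = h (E i) \<otimes>\<^bsub>N\<^esub> inv\<^bsub>N\<^esub> h (E l)"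
      using FG EG by (auto simp: u_def t_def)
    ultimately show "iterated_commutator N (h (F i) \<otimes>\<^bsub>N\<^esub> inv\<^bsub>N\<^esub> h (F j))
        (h (E i) \<otimes>\<^bsub>N\<^esub> inv\<^bsub>N\<^esub> h (E l)) k \<noteq> \<one>\<^bsub>N\<^esub>"
      using h.hom_iterated_commutator[OF uG tG, of k] by simp
  qed
  ultimately show ?thesis
    using N normal Z_card by blast
qed

end
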